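(* Let $G$ be a countable abelian group acting on a probability space $(X, \mathcal{B}, \mu)$. Then for every positive integer $k$, all $A_1, A_2, \ldots, A_k \subset G$ and every non-null $B \in \mathcal{B}$ we have $$ c(A_1 \cdots A_k, B) \leq \prod_{i=1}^k \frac{\mu(A_i B)}{\mu(B)}.$$
   Context: A group $G$ acts on a measure space $(X,\mathcal{B},\mu)$ if for each $g\in G$ the map $x\mapsto g.x$ is measure preserving, i.e. it is measurable and $\mu(gB)=\mu(B)$ for every $B\in\mathcal{B}$. For $A\subset G$ and $B\subset X$, $AB=\{a.b : a\in A, b\in B\}$. For $A_1,\dots,A_k\subset G$, $A_1\cdots A_k=\{a_1\cdots a_k : a_i\in A_i\}$. For $A\subset G$ and $B\in\mathcal{B}$ of finite positive measure, the magnification ratio is $$c(A,B)=\inf\left\{\frac{\mu(AB')}{\mu(B')} : B'\subset B \text{ measurable},\ \mu(B')>0\right\}.$$ *)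

theory Defs
  imports "HOL-Probability.Probability" "HOL-Algebra.Group_Action"
    "HOL-Algebra.FiniteProduct"
begin

text \<open>
  The library locale \<^locale>\<open>group_action\<close> presents an action on the points of
  \<open>space M\<close> as a homomorphism \<open>\<phi>\<close> into the group of bijections of \<open>space M\<close>, so
  \<open>g.x\<close> is \<open>\<phi> g x\<close>. Sets \<open>\<phi> g ` B\<close> with \<open>B \<in> sets M\<close> are automatically in \<open>sets M\<close>,
  since \<open>\<phi> g ` B\<close> is the preimage of \<open>B\<close> under the measurable map
  \<open>\<phi> (inv\<^bsub>G\<^esub> g)\<close>; hence so are unions of
  countably many of them, and \<open>emeasure\<close> is not used at its default value \<open>0\<close>.
\<close>

locale measure_preserving_action = group_action G "space M" \<phi>
  for G (structure) and M :: "'x measure" and \<phi> +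
  assumes action_measurable: "g \<in> carrier G \<Longrightarrow> \<phi> g \<in> measurable M M"
    and action_emeasure:
      "g \<in> carrier G \<Longrightarrow> B \<in> sets M \<Longrightarrow> emeasure M (\<phi> g ` B) = emeasure M B"

definition act_set :: "('g \<Rightarrow> 'x \<Rightarrow> 'x) \<Rightarrow> 'g set \<Rightarrow> 'x set \<Rightarrow> 'x set" where
  "act_set \<phi> A B = {\<phi> a b | a b. a \<in> A \<and> b \<in> B}"

text \<open>
  The set \<open>A 1 \<cdots> A k\<close>. Being stated with \<^const>\<open>finprod\<close>, it is meaningful only
  for commutative \<open>G\<close>.
\<close>

definition product_set :: "('g, 'm) monoid_scheme \<Rightarrow> nat \<Rightarrow> (nat \<Rightarrow> 'g set) \<Rightarrow> 'g set" where
  "product_set G k A = {finprod G a {1..k} | a. \<forall>i\<in>{1..k}. a i \<in> A i}"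

text \<open>
  Intended for \<open>B \<in> sets M\<close> of finite positive measure; the infimum is then over a
  nonempty set and every denominator is finite and nonzero. Values are in
  \<^typ>\<open>ennreal\<close> because \<open>AB'\<close> may have infinite measure if \<open>M\<close> is not finite.
\<close>

definition magnification_ratio ::
    "'x measure \<Rightarrow> ('g \<Rightarrow> 'x \<Rightarrow> 'x) \<Rightarrow> 'g set \<Rightarrow> 'x set \<Rightarrow> ennreal" where
  "magnification_ratio M \<phi> A B =
     Inf {emeasure M (act_set \<phi> A B') / emeasure M B' | B'.
            B' \<in> sets M \<and> B' \<subseteq> B \<and> emeasure M B' > 0}"

end

theory Submission imports Defs "HOL-Algebra.Product_Groups" begin

text \<open>
  Write \<open>\<alpha>\<^sub>i = \<mu>(A\<^sub>i B) / \<mu>(B)\<close>, and assume that no \<open>A\<^sub>i\<close> is empty, so that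
  \<open>\<alpha>\<^sub>i \<ge> 1\<close>. The proof combines Petridis's argument for Pluennecke's inequality with the
  tensor power trick.

  Petridis's argument. The functional \<open>F(Z) = \<Sum>\<^sub>i \<mu>(A\<^sub>i Z) / \<alpha>\<^sub>i\<close> is monotone, submodular
  and continuous from below, and, since \<open>G\<close> is abelian, it is invariant under \<open>G\<close>. As
  \<open>F(B) = k \<mu>(B)\<close>, the functional \<open>J = F - (k + 1) \<mu>\<close> is negative at \<open>B\<close>. By
  submodularity \<open>J\<close> attains its minimum over the measurable subsets of \<open>B\<close>
  (\<open>exists_minimiser\<close>), at \<open>W\<close> say; then \<open>J(W) < 0\<close>, so \<open>W\<close> is not null. Submodularity,
  invariance and minimality give \<open>J(C W) \<le> J(W) < 0\<close> for every nonempty \<open>C \<subseteq> G\<close>, by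
  adding the elements of \<open>C\<close> one after the other (\<open>penalised_act_set_le\<close>). Hence
  \<open>\<mu>(A\<^sub>i C W) \<le> (k + 1) \<alpha>\<^sub>i \<mu>(C W)\<close> for all \<open>i\<close> and \<open>C\<close> with the same \<open>W\<close>, and iterating
  over \<open>i\<close> yields \<open>\<mu>(A\<^sub>1 \<cdots> A\<^sub>k W) \<le> K \<Prod>\<^sub>i \<alpha>\<^sub>i \<mu>(W)\<close> with \<open>K = (k + 1)\<^sup>k\<close>
  (\<open>exists_subset_product_growth\<close>). This is the claim up to the constant \<open>K\<close>, which depends
  on \<open>k\<close> alone.

  Minimising with the penalty \<open>k + 1\<close>, rather than minimising the ratio \<open>F / \<mu>\<close> itself,
  is what makes an exact minimiser available in a measure space: an almost minimiser of the
  ratio would lead to an error that grows with \<open>C\<close>.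

  Tensor power trick. The constant does not change when the action of \<open>G\<close> on \<open>X\<close> is replaced
  by the coordinatewise action of \<open>G\<^sup>n\<close> on \<open>X\<^sup>n\<close>, the sets \<open>A\<^sub>i\<close> and \<open>B\<close> by their powers,
  and \<open>\<alpha>\<^sub>i\<close> by its \<open>n\<close>th power. By Fubini's theorem, one coordinate at a time, the
  magnification ratio satisfies \<open>c(A, B)\<^sup>n \<le> c(A\<^sup>n, B\<^sup>n)\<close> (\<open>growth_power\<close>). With
  \<open>A = A\<^sub>1 \<cdots> A\<^sub>k\<close> this means that the \<open>n\<close>th power of \<open>c(A, B)\<close> is at most \<open>K\<close> times the
  \<open>n\<close>th power of \<open>\<Prod>\<^sub>i \<alpha>\<^sub>i\<close>, for every \<open>n\<close>, and the constant disappears as \<open>n\<close> tends to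
  infinity (\<open>uniform_growth_le_prod\<close>).
\<close>

section \<open>Minimisers of penalised submodular functionals\<close>

locale submodular_functional = finite_measure M for M :: "'x measure" +
  fixes F :: "'x set \<Rightarrow> real"
  assumes nonneg: "Z \<in> sets M \<Longrightarrow> 0 \<le> F Z"
    and mono: "Y \<in> sets M \<Longrightarrow> Z \<in> sets M \<Longrightarrow> Y \<subseteq> Z \<Longrightarrow> F Y \<le> F Z"
    and submodular: "Y \<in> sets M \<Longrightarrow> Z \<in> sets M \<Longrightarrow> F (Y \<union> Z) + F (Y \<inter> Z) \<le> F Y + F Z"
    and continuous_from_below:
      "range V \<subseteq> sets M \<Longrightarrow> incseq V \<Longrightarrow> (\<lambda>n. F (V n)) \<longlonglongrightarrow> F (\<Union>n::nat. V n)"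
begin

lemma submodular_penalised:
  assumes "Y \<in> sets M" "Z \<in> sets M"
  shows "(F (Y \<union> Z) - L * measure M (Y \<union> Z)) + (F (Y \<inter> Z) - L * measure M (Y \<inter> Z))
    \<le> (F Y - L * measure M Y) + (F Z - L * measure M Z)"
proof -
  have "measure M (Y \<union> Z) = measure M Y + measure M Z - measure M (Y \<inter> Z)"
    using assms by (intro measure_Un3) (auto simp: fmeasurable_eq_sets)
  hence "L * measure M (Y \<union> Z) = L * measure M Y + L * measure M Z - L * measure M (Y \<inter> Z)"
    by (simp only: ring_distribs)
  thus ?thesis using submodular[OF assms] by linarith
qed

lemma penalised_continuous_from_below:
  assumes "range V \<subseteq> sets M" "incseq V"
  shows "(\<lambda>n. F (V n) - L * measure M (V n)) \<longlonglongrightarrow> F (\<Union>n. V n) - L * measure M (\<Union>n. V n)"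
  using assms by (intro tendsto_intros continuous_from_below finite_Lim_measure_incseq)

text \<open>
  For a sequence \<open>Z\<close> with \<open>J (Z n) < inf J + 1/2^n\<close>, submodularity makes the excess of \<open>J\<close> over
  its infimum subadditive under unions, because intersections cannot go below the infimum. So
  the tails \<open>T n = (\<Union>i\<ge>n. Z i)\<close> have excess at most \<open>2/2^n\<close>, by continuity from below. Their
  intersection is a minimiser: \<open>F\<close> need not be continuous from above, but monotonicity gives
  the inequality in the required direction.
\<close>

proposition exists_minimiser:
  assumes B: "B \<in> sets M" and L: "0 \<le> L"
  obtains W where "W \<in> sets M" "W \<subseteq> B"
    "\<And>Z. Z \<in> sets M \<Longrightarrow> Z \<subseteq> B \<Longrightarrow> F W - L * measure M W \<le> F Z - L * measure M Z"
proof -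
  define J where "J Z = F Z - L * measure M Z" for Z
  define S where "S = {Z \<in> sets M. Z \<subseteq> B}"
  define m where "m = Inf (J ` S)"
  have bound: "- L * measure M (space M) \<le> J Z" if "Z \<in> S" for Z
    using that nonneg[of Z] mult_left_mono[OF bounded_measure[of Z] L] by (auto simp: J_def S_def)
  have bdd: "bdd_below (J ` S)"
    using bound by (auto simp: bdd_below_def)
  have ne: "J ` S \<noteq> {}" using B by (auto simp: S_def)
  have m_le: "m \<le> J Z" if "Z \<in> S" for Z
    unfolding m_def using that bdd by (intro cInf_lower) auto
  have "\<exists>Z\<in>S. J Z < m + (1/2)^n" for n :: nat
    using cInf_lessD[OF ne, of "m + (1/2)^n"] unfolding m_def by auto
  then obtain Z where Z: "\<And>n. Z n \<in> S" "\<And>n. J (Z n) < m + (1/2)^n" by metis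
  define V where "V n p = (\<Union>i\<in>{n..n+p}. Z i)" for n p :: nat
  define T where "T n = (\<Union>p. V n p)" for n
  define W where "W = (\<Inter>n. T n)"
  have VS: "V n p \<in> S" for n p using Z(1) by (auto simp: V_def S_def)
  have TS: "T n \<in> S" for n using VS by (auto simp: T_def S_def)
  have WS: "W \<in> S" using TS by (auto simp: W_def S_def)
  \<comment> \<open>The right-hand side is \<open>m\<close> plus the geometric sum bounding the excesses of \<open>Z n, ..., Z (n+p)\<close>.\<close>
  have V_bound: "J (V n p) \<le> m + 2 * (1/2)^n - (1/2)^(n+p)" for n p
  proof (induction p)
    case 0
    then show ?case using Z(2)[of n] by (simp add: V_def)
  next
    case (Suc p)
    have eq: "V n (Suc p) = V n p \<union> Z (n + Suc p)"
      by (auto simp: V_def atLeastAtMostSuc_conv)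
    have "m \<le> J (V n p \<inter> Z (n + Suc p))"
      using VS[of n p] Z(1)[of "n + Suc p"] by (intro m_le) (auto simp: S_def)
    moreover have "J (V n p \<union> Z (n + Suc p)) + J (V n p \<inter> Z (n + Suc p))
        \<le> J (V n p) + J (Z (n + Suc p))"
      using VS[of n p] Z(1)[of "n + Suc p"] unfolding J_def
      by (intro submodular_penalised) (auto simp: S_def)
    ultimately show ?case using Suc.IH Z(2)[of "n + Suc p"] unfolding eq by simp
  qed
  have T_bound: "J (T n) \<le> m + 2 * (1/2)^n" for n
  proof (rule LIMSEQ_le_const2)
    show "(\<lambda>p. J (V n p)) \<longlonglongrightarrow> J (T n)"
      unfolding J_def T_def using VS
      by (intro penalised_continuous_from_below) (auto simp: S_def V_def incseq_def, fastforce)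
    have "J (V n p) \<le> m + 2 * (1/2)^n" for p
      using V_bound[of n p] zero_less_power[of "1/2::real" "n+p"] by linarith
    thus "\<exists>N. \<forall>p\<ge>N. J (V n p) \<le> m + 2 * (1/2)^n" by auto
  qed
  have "F W - L * measure M W \<le> m"
  proof -
    have dec: "decseq T"
    proof (rule decseq_SucI)
      show "T (Suc n) \<subseteq> T n" for n
      proof
        fix x assume "x \<in> T (Suc n)"
        then obtain p i where "i \<in> {Suc n..Suc n + p}" "x \<in> Z i" by (auto simp: T_def V_def)
        hence "x \<in> V n (Suc p)" by (auto simp: V_def intro!: bexI[of _ i])
        thus "x \<in> T n" by (auto simp: T_def)
      qed
    qed
    have "(\<lambda>n. measure M (T n)) \<longlonglongrightarrow> measure M W"
      unfolding W_def using TS dec by (intro finite_Lim_measure_decseq) (auto simp: S_def)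
    hence lim: "(\<lambda>n. m + 2 * (1/2)^n + L * measure M (T n)) \<longlonglongrightarrow> m + 2 * 0 + L * measure M W"
      by (intro tendsto_intros LIMSEQ_realpow_zero) auto
    have "F W \<le> m + 2 * (1/2)^n + L * measure M (T n)" for n
    proof -
      have "F W \<le> F (T n)" using WS TS[of n] by (intro mono) (auto simp: S_def W_def)
      thus ?thesis using T_bound[of n] by (simp add: J_def)
    qed
    hence "F W \<le> m + 2 * 0 + L * measure M W"
      by (intro LIMSEQ_le_const[OF lim]) auto
    thus ?thesis by simp
  qed
  with m_le WS that[of W] show thesis by (force simp: S_def J_def)
qed

end

section \<open>Measure preserving actions of countable abelian groups\<close>

lemma act_set_eq_UN: "act_set \<phi> A Z = (\<Union>a\<in>A. \<phi> a ` Z)"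
  by (auto simp: act_set_def)

lemma act_set_mono: "A \<subseteq> A' \<Longrightarrow> Z \<subseteq> Z' \<Longrightarrow> act_set \<phi> A Z \<subseteq> act_set \<phi> A' Z'"
  by (auto simp: act_set_def)

lemma act_set_Un: "act_set \<phi> A (Y \<union> Z) = act_set \<phi> A Y \<union> act_set \<phi> A Z"
  by (auto simp: act_set_def)

lemma act_set_UN: "act_set \<phi> A (\<Union>i\<in>I. Z i) = (\<Union>i\<in>I. act_set \<phi> A (Z i))"
  by (auto simp: act_set_def)

locale abelian_pmp_action =
  measure_preserving_action G M \<phi> + comm_group G + prob_space M
  for G (structure) and M :: "'x measure" and \<phi> +
  assumes countable_carrier: "countable (carrier G)"
begin

lemma action_closed: "g \<in> carrier G \<Longrightarrow> x \<in> space M \<Longrightarrow> \<phi> g x \<in> space M"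
  using element_image by blast

lemma action_one: "x \<in> space M \<Longrightarrow> \<phi> \<one> x = x"
  using id_eq_one by (metis restrict_apply')

lemma action_inv_cancel:
  assumes "g \<in> carrier G" "x \<in> space M"
  shows "\<phi> (inv g) (\<phi> g x) = x" "\<phi> g (\<phi> (inv g) x) = x"
  using assms composition_rule[of x "inv g" g] composition_rule[of x g "inv g"] action_one
  by auto

lemma action_commute:
  assumes "g \<in> carrier G" "h \<in> carrier G" "x \<in> space M"
  shows "\<phi> g (\<phi> h x) = \<phi> h (\<phi> g x)"
  using assms composition_rule[of x g h] composition_rule[of x h g] m_comm[of g h] by simp

lemma image_eq_vimage_inv:
  assumes "g \<in> carrier G" "Z \<subseteq> space M"
  shows "\<phi> g ` Z = \<phi> (inv g) -` Z \<inter> space M"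
proof (intro equalityI subsetI)
  fix x assume "x \<in> \<phi> (inv g) -` Z \<inter> space M"
  thus "x \<in> \<phi> g ` Z" using assms action_inv_cancel(2)[of g x] by (metis IntE image_eqI vimageE)
qed (use assms in \<open>auto simp: action_inv_cancel action_closed subset_iff\<close>)

lemma image_sets:
  assumes "g \<in> carrier G" "Z \<in> sets M"
  shows "\<phi> g ` Z \<in> sets M"
  using assms by (subst image_eq_vimage_inv)
    (auto intro!: measurable_sets[OF action_measurable] dest: sets.sets_into_space)

lemma measure_image: "g \<in> carrier G \<Longrightarrow> Z \<in> sets M \<Longrightarrow> measure M (\<phi> g ` Z) = measure M Z"
  by (simp add: measure_def action_emeasure)

lemma countable_subset_carrier: "A \<subseteq> carrier G \<Longrightarrow> countable A"
  using countable_carrier countable_subset by blast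

lemma act_set_sets [intro]:
  assumes "A \<subseteq> carrier G" "Z \<in> sets M"
  shows "act_set \<phi> A Z \<in> sets M"
  unfolding act_set_eq_UN
proof (rule sets.countable_UN')
  show "countable A" using assms by (intro countable_subset_carrier)
  show "(\<lambda>a. \<phi> a ` Z) ` A \<subseteq> sets M" using assms image_sets by auto
qed

lemma act_set_image:
  assumes "A \<subseteq> carrier G" "g \<in> carrier G" "Z \<subseteq> space M"
  shows "act_set \<phi> A (\<phi> g ` Z) = \<phi> g ` act_set \<phi> A Z"
  unfolding act_set_eq_UN image_UN image_image
  using assms by (intro SUP_cong refl image_cong) (auto intro!: action_commute)

lemma act_set_act_set:
  assumes "A \<subseteq> carrier G" "C \<subseteq> carrier G" "Z \<subseteq> space M"
  shows "act_set \<phi> A (act_set \<phi> C Z) = act_set \<phi> (A <#> C) Z"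
proof -
  have "\<phi> (a \<otimes> c) z = \<phi> a (\<phi> c z)" if "a \<in> A" "c \<in> C" "z \<in> Z" for a c z
    using that assms by (intro composition_rule) auto
  thus ?thesis unfolding act_set_eq_UN set_mult_def
    by (auto 0 4 simp: image_iff)
qed

lemma measure_le_act_set:
  assumes "A \<subseteq> carrier G" "A \<noteq> {}" "Z \<in> sets M"
  shows "measure M Z \<le> measure M (act_set \<phi> A Z)"
proof -
  obtain a where a: "a \<in> A" using assms by blast
  hence "measure M Z = measure M (\<phi> a ` Z)" using assms by (subst measure_image) auto
  also have "\<dots> \<le> measure M (act_set \<phi> A Z)"
    using assms a by (intro finite_measure_mono act_set_sets) (auto simp: act_set_eq_UN)
  finally show ?thesis .
qed

section \<open>Petridis's argument\<close>

text \<open>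
  Submodularity rests on the fact that acting by a set commutes with unions, whereas
  \<open>A (Y \<inter> Z) \<subseteq> A Y \<inter> A Z\<close>.
\<close>

lemma submodular_functional_act_sets:
  assumes A: "\<And>i. i \<in> I \<Longrightarrow> A i \<subseteq> carrier G" and w: "\<And>i. i \<in> I \<Longrightarrow> 0 \<le> w i"
  shows "submodular_functional M (\<lambda>Z. \<Sum>i\<in>I. w i * measure M (act_set \<phi> (A i) Z))"
proof unfold_locales
  fix Y Z assume YZ: "Y \<in> sets M" "Z \<in> sets M"
  show "0 \<le> (\<Sum>i\<in>I. w i * measure M (act_set \<phi> (A i) Z))"
    using w by (intro sum_nonneg) auto
  show "(\<Sum>i\<in>I. w i * measure M (act_set \<phi> (A i) Y)) \<le> (\<Sum>i\<in>I. w i * measure M (act_set \<phi> (A i) Z))"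
    if "Y \<subseteq> Z"
    using w A YZ that by (intro sum_mono mult_left_mono finite_measure_mono act_set_mono act_set_sets) auto
  have "w i * measure M (act_set \<phi> (A i) (Y \<union> Z)) + w i * measure M (act_set \<phi> (A i) (Y \<inter> Z))
      \<le> w i * measure M (act_set \<phi> (A i) Y) + w i * measure M (act_set \<phi> (A i) Z)" if i: "i \<in> I" for i
  proof -
    have "measure M (act_set \<phi> (A i) Y \<union> act_set \<phi> (A i) Z)
       = measure M (act_set \<phi> (A i) Y) + measure M (act_set \<phi> (A i) Z)
         - measure M (act_set \<phi> (A i) Y \<inter> act_set \<phi> (A i) Z)"
      using YZ A[OF i] by (intro measure_Un3) (auto simp: fmeasurable_eq_sets)
    moreover have "measure M (act_set \<phi> (A i) (Y \<inter> Z))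
        \<le> measure M (act_set \<phi> (A i) Y \<inter> act_set \<phi> (A i) Z)"
      using YZ A[OF i] by (intro finite_measure_mono) (auto simp: act_set_eq_UN intro!: sets.Int
        act_set_sets[unfolded act_set_eq_UN])
    ultimately have "measure M (act_set \<phi> (A i) (Y \<union> Z)) + measure M (act_set \<phi> (A i) (Y \<inter> Z))
      \<le> measure M (act_set \<phi> (A i) Y) + measure M (act_set \<phi> (A i) Z)"
      unfolding act_set_Un by linarith
    from mult_left_mono[OF this w[OF i]] show ?thesis by (simp add: algebra_simps)
  qed
  thus "(\<Sum>i\<in>I. w i * measure M (act_set \<phi> (A i) (Y \<union> Z)))
      + (\<Sum>i\<in>I. w i * measure M (act_set \<phi> (A i) (Y \<inter> Z)))
      \<le> (\<Sum>i\<in>I. w i * measure M (act_set \<phi> (A i) Y)) + (\<Sum>i\<in>I. w i * measure M (act_set \<phi> (A i) Z))"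
    unfolding sum.distrib[symmetric] by (intro sum_mono)
next
  fix V :: "nat \<Rightarrow> 'x set" assume V: "range V \<subseteq> sets M" "incseq V"
  show "(\<lambda>n. \<Sum>i\<in>I. w i * measure M (act_set \<phi> (A i) (V n)))
     \<longlonglongrightarrow> (\<Sum>i\<in>I. w i * measure M (act_set \<phi> (A i) (\<Union>n. V n)))"
    unfolding act_set_UN
  proof (intro tendsto_intros finite_Lim_measure_incseq)
    fix i assume i: "i \<in> I"
    show "range (\<lambda>n. act_set \<phi> (A i) (V n)) \<subseteq> sets M"
      using V A[OF i] by blast
    show "incseq (\<lambda>n. act_set \<phi> (A i) (V n))"
      using V by (intro incseq_SucI act_set_mono order_refl) (simp add: incseq_SucD)
  qed
qed

text \<open>
  Adding one translate \<open>gW\<close> to a union \<open>V\<close> of translates does not increase \<open>J\<close>: by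
  submodularity \<open>J(V \<union> gW) \<le> J(V) + J(gW) - J(V \<inter> gW)\<close>, where \<open>J(gW) = J(W)\<close> by invariance, and
  \<open>V \<inter> gW\<close> is a translate of a subset of \<open>W\<close>, so that \<open>J\<close> is at least \<open>J(W)\<close> there. Infinite
  \<open>C\<close> are reached by continuity from below.
\<close>

proposition penalised_act_set_le:
  assumes F: "submodular_functional M F"
    and inv: "\<And>g Z. g \<in> carrier G \<Longrightarrow> Z \<in> sets M \<Longrightarrow> F (\<phi> g ` Z) = F Z"
    and W: "W \<in> sets M" "W \<subseteq> B"
    and minimal: "\<And>Z. Z \<in> sets M \<Longrightarrow> Z \<subseteq> B \<Longrightarrow> F W - L * measure M W \<le> F Z - L * measure M Z"
    and C: "C \<subseteq> carrier G" "C \<noteq> {}"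
  shows "F (act_set \<phi> C W) - L * measure M (act_set \<phi> C W) \<le> F W - L * measure M W"
proof -
  interpret submodular_functional M F by fact
  define J where "J Z = F Z - L * measure M Z" for Z
  have J_inv: "J (\<phi> g ` Z) = J Z" if "g \<in> carrier G" "Z \<in> sets M" for g Z
    using that by (simp add: J_def inv measure_image)
  define c where "c = from_nat_into C"
  have range_c: "range c = C"
    unfolding c_def using C countable_subset_carrier by (intro range_from_nat_into) auto
  hence c: "c n \<in> carrier G" for n using C by blast
  define V where "V n = (\<Union>i\<le>n. \<phi> (c i) ` W)" for n
  have V_sets: "V n \<in> sets M" for n unfolding V_def using c W by (auto intro!: image_sets)
  have bound: "J (V n) \<le> J W" for n
  proof (induction n)
    case 0
    then show ?case using c[of 0] W by (simp add: V_def J_inv)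
  next
    case (Suc n)
    define g where "g = c (Suc n)"
    have g: "g \<in> carrier G" by (simp add: g_def c)
    \<comment> \<open>Minimality is known only inside \<open>B\<close>, hence the translation back into \<open>W\<close>.\<close>
    define Y where "Y = \<phi> (inv g) ` (V n \<inter> \<phi> g ` W)"
    have Y_sets: "Y \<in> sets M"
      unfolding Y_def using g V_sets W by (intro image_sets) (auto intro: image_sets)
    have "Y \<subseteq> W"
      unfolding Y_def using g sets.sets_into_space[OF W(1)] by (auto simp: action_inv_cancel subset_iff)
    hence "J W \<le> J Y" unfolding J_def using W Y_sets by (intro minimal) auto
    also have "J Y = J (V n \<inter> \<phi> g ` W)"
      unfolding Y_def using g V_sets W by (intro J_inv) (auto intro: image_sets)
    finally have 1: "J W \<le> J (V n \<inter> \<phi> g ` W)" .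
    have 2: "J (V n \<union> \<phi> g ` W) + J (V n \<inter> \<phi> g ` W) \<le> J (V n) + J (\<phi> g ` W)"
      unfolding J_def using V_sets g W by (intro submodular_penalised image_sets)
    have "V (Suc n) = V n \<union> \<phi> g ` W" by (auto simp: V_def g_def atMost_Suc)
    thus ?case using 1 2 Suc.IH J_inv[OF g W(1)] by simp
  qed
  have "act_set \<phi> C W = (\<Union>n. V n)"
    unfolding act_set_eq_UN range_c[symmetric] V_def by auto
  moreover have "(\<lambda>n. J (V n)) \<longlonglongrightarrow> J (\<Union>n. V n)"
    unfolding J_def using V_sets
    by (intro penalised_continuous_from_below) (auto simp: V_def incseq_def, fastforce)
  hence "J (\<Union>n. V n) \<le> J W"
    using bound by (intro LIMSEQ_le_const2) auto
  ultimately show ?thesis by (simp add: J_def)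
qed

text \<open>
  Invariance comes from \<open>A (gZ) = g (A Z)\<close>, which holds because the group is abelian.
\<close>

lemma weighted_act_set_image:
  assumes A: "\<And>i. i \<in> I \<Longrightarrow> A i \<subseteq> carrier G" and g: "g \<in> carrier G" and Z: "Z \<in> sets M"
  shows "(\<Sum>i\<in>I. w i * measure M (act_set \<phi> (A i) (\<phi> g ` Z)))
    = (\<Sum>i\<in>I. w i * measure M (act_set \<phi> (A i) Z))"
proof (intro sum.cong refl)
  fix i assume "i \<in> I"
  thus "w i * measure M (act_set \<phi> (A i) (\<phi> g ` Z)) = w i * measure M (act_set \<phi> (A i) Z)"
    using A g Z sets.sets_into_space[OF Z] by (simp add: act_set_image measure_image act_set_sets)
qed

text \<open>
  The weights \<open>1 / c i\<close> bring all the growth conditions to the same scale, so that a single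
  set \<open>W\<close> works for every \<open>A i\<close>. Since \<open>F B \<le> card I * measure M B\<close>, any penalty above
  \<open>card I\<close> makes the minimum negative, and therefore the minimiser non-null.
\<close>

proposition common_minimiser:
  fixes c :: "'i \<Rightarrow> real"
  assumes I: "finite I"
    and A: "\<And>i. i \<in> I \<Longrightarrow> A i \<subseteq> carrier G"
    and B: "B \<in> sets M" "0 < measure M B"
    and c: "\<And>i. i \<in> I \<Longrightarrow> 0 < c i"
    and growth: "\<And>i. i \<in> I \<Longrightarrow> measure M (act_set \<phi> (A i) B) \<le> c i * measure M B"
  obtains W where "W \<in> sets M" "W \<subseteq> B" "0 < measure M W"
    "\<And>i C. i \<in> I \<Longrightarrow> C \<subseteq> carrier G \<Longrightarrow>
       measure M (act_set \<phi> (A i) (act_set \<phi> C W))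
         \<le> (real (card I) + 1) * c i * measure M (act_set \<phi> C W)"
proof -
  define F where "F Z = (\<Sum>i\<in>I. inverse (c i) * measure M (act_set \<phi> (A i) Z))" for Z
  define L where "L = real (card I) + 1"
  interpret submodular_functional M F
    unfolding F_def using A c by (intro submodular_functional_act_sets) (auto simp: less_imp_le)
  have F_inv: "F (\<phi> g ` Z) = F Z" if "g \<in> carrier G" "Z \<in> sets M" for g Z
    unfolding F_def using A that by (intro weighted_act_set_image)
  obtain W where W: "W \<in> sets M" "W \<subseteq> B" and
    minimal: "\<And>Z. Z \<in> sets M \<Longrightarrow> Z \<subseteq> B \<Longrightarrow> F W - L * measure M W \<le> F Z - L * measure M Z"
    using exists_minimiser[OF B(1), of L] by (auto simp: L_def)
  have "F B \<le> (\<Sum>i\<in>I. measure M B)"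
    unfolding F_def
  proof (rule sum_mono)
    fix i assume i: "i \<in> I"
    show "inverse (c i) * measure M (act_set \<phi> (A i) B) \<le> measure M B"
      using growth[OF i] c[OF i] by (simp add: field_simps)
  qed
  hence "F B - L * measure M B < 0"
    using B by (simp add: L_def algebra_simps)
  hence neg: "F W - L * measure M W < 0"
    using minimal[OF B(1)] by simp
  moreover have "0 \<le> F W" using nonneg W by blast
  ultimately have "0 < L * measure M W" by linarith
  hence "measure M W \<noteq> 0" by auto
  hence pos: "0 < measure M W" by (simp add: zero_less_measure_iff)
  show thesis
  proof (rule that[OF W pos])
    fix i C assume i: "i \<in> I" and C: "C \<subseteq> carrier G"
    have "F (act_set \<phi> C W) - L * measure M (act_set \<phi> C W) \<le> 0"
    proof (cases "C = {}")
      case True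
      thus ?thesis by (simp add: F_def act_set_def)
    next
      case False
      have "F (act_set \<phi> C W) - L * measure M (act_set \<phi> C W) \<le> F W - L * measure M W"
        by (rule penalised_act_set_le[OF submodular_functional_axioms _ W _ C False])
          (fact F_inv minimal)+
      thus ?thesis using neg by linarith
    qed
    moreover have "inverse (c i) * measure M (act_set \<phi> (A i) (act_set \<phi> C W)) \<le> F (act_set \<phi> C W)"
      unfolding F_def using c I i
      by (intro member_le_sum) (auto simp: less_imp_le)
    ultimately have "inverse (c i) * measure M (act_set \<phi> (A i) (act_set \<phi> C W))
        \<le> L * measure M (act_set \<phi> C W)" by linarith
    thus "measure M (act_set \<phi> (A i) (act_set \<phi> C W))
         \<le> (real (card I) + 1) * c i * measure M (act_set \<phi> C W)"
      using c[OF i] by (simp add: L_def field_simps)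
  qed
qed

end

section \<open>The inequality up to a constant\<close>

lemma (in comm_monoid) product_set_0: "product_set G 0 A = {\<one>}"
  by (simp add: product_set_def)

lemma (in comm_monoid) product_set_Suc:
  assumes A: "\<And>i. i \<in> {1..Suc k} \<Longrightarrow> A i \<subseteq> carrier G"
  shows "product_set G (Suc k) A = A (Suc k) <#> product_set G k A"
proof -
  have ins: "{1..Suc k} = insert (Suc k) {1..k}" by auto
  have split: "finprod G a {1..Suc k} = a (Suc k) \<otimes> finprod G a {1..k}"
    if "\<forall>i\<in>{1..Suc k}. a i \<in> A i" for a
  proof -
    have "a i \<in> carrier G" if "i \<in> {1..Suc k}" for i
      using that \<open>\<forall>i\<in>{1..Suc k}. a i \<in> A i\<close> A by blast
    thus ?thesis unfolding ins by (intro finprod_insert) auto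
  qed
  show ?thesis
  proof (intro equalityI subsetI)
    fix x assume "x \<in> product_set G (Suc k) A"
    then obtain a where a: "\<forall>i\<in>{1..Suc k}. a i \<in> A i" and x: "x = finprod G a {1..Suc k}"
      by (auto simp: product_set_def)
    have "finprod G a {1..k} \<in> product_set G k A" using a by (auto simp: product_set_def)
    thus "x \<in> A (Suc k) <#> product_set G k A"
      unfolding x split[OF a] set_mult_def using a by auto
  next
    fix x assume "x \<in> A (Suc k) <#> product_set G k A"
    then obtain y a where y: "y \<in> A (Suc k)" and a: "\<forall>i\<in>{1..k}. a i \<in> A i"
      and x: "x = y \<otimes> finprod G a {1..k}"
      by (auto simp: product_set_def set_mult_def)
    define b where "b = a(Suc k := y)"
    have b: "\<forall>i\<in>{1..Suc k}. b i \<in> A i" using a y by (auto simp: b_def)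
    have "finprod G b {1..k} = finprod G a {1..k}"
    proof (rule finprod_cong')
      show "a \<in> {1..k} \<rightarrow> carrier G"
      proof
        fix i assume "i \<in> {1..k}"
        thus "a i \<in> carrier G" using a A[of i] by auto
      qed
    qed (auto simp: b_def)
    moreover have "b (Suc k) = y" by (simp add: b_def)
    ultimately have "x = finprod G b {1..Suc k}" using split[OF b] x by simp
    thus "x \<in> product_set G (Suc k) A" using b by (auto simp: product_set_def)
  qed
qed

lemma (in comm_monoid) product_set_closed:
  assumes A: "\<And>i. i \<in> {1..k} \<Longrightarrow> A i \<subseteq> carrier G"
  shows "product_set G k A \<subseteq> carrier G"
proof
  fix x assume "x \<in> product_set G k A"
  then obtain a where a: "\<forall>i\<in>{1..k}. a i \<in> A i" and x: "x = finprod G a {1..k}"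
    by (auto simp: product_set_def)
  have "a i \<in> carrier G" if "i \<in> {1..k}" for i using that a A by blast
  thus "x \<in> carrier G" unfolding x by (intro finprod_closed) auto
qed

context abelian_pmp_action
begin

text \<open>
  The factors are applied one at a time, with the product of the previous ones as the set
  \<open>C\<close> of the common minimiser.
\<close>

proposition exists_subset_product_growth:
  fixes c :: "nat \<Rightarrow> real"
  assumes A: "\<And>i. i \<in> {1..k} \<Longrightarrow> A i \<subseteq> carrier G"
    and B: "B \<in> sets M" "0 < measure M B"
    and c: "\<And>i. i \<in> {1..k} \<Longrightarrow> 0 < c i"
    and growth: "\<And>i. i \<in> {1..k} \<Longrightarrow> measure M (act_set \<phi> (A i) B) \<le> c i * measure M B"
  obtains W where "W \<in> sets M" "W \<subseteq> B" "0 < measure M W"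
    "measure M (act_set \<phi> (product_set G k A) W) \<le> (real k + 1) ^ k * (\<Prod>i=1..k. c i) * measure M W"
proof -
  obtain W where W: "W \<in> sets M" "W \<subseteq> B" "0 < measure M W" and
    step: "\<And>i C. i \<in> {1..k} \<Longrightarrow> C \<subseteq> carrier G \<Longrightarrow>
       measure M (act_set \<phi> (A i) (act_set \<phi> C W)) \<le> (real k + 1) * c i * measure M (act_set \<phi> C W)"
    using common_minimiser[of "{1..k}" A B c] A B c growth by auto
  have space: "W \<subseteq> space M" using W sets.sets_into_space by blast
  have "measure M (act_set \<phi> (product_set G j A) W) \<le> (real k + 1) ^ j * (\<Prod>i=1..j. c i) * measure M W"
    if "j \<le> k" for j
    using that
  proof (induction j)
    case 0
    have "act_set \<phi> {\<one>} W = W" using space by (force simp: act_set_eq_UN action_one image_iff)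
    thus ?case by (simp add: product_set_0)
  next
    case (Suc j)
    have closed: "product_set G j A \<subseteq> carrier G" using A Suc.prems by (intro product_set_closed) auto
    have "act_set \<phi> (product_set G (Suc j) A) W
        = act_set \<phi> (A (Suc j)) (act_set \<phi> (product_set G j A) W)"
      using A Suc.prems space closed by (subst product_set_Suc) (auto simp: act_set_act_set)
    hence "measure M (act_set \<phi> (product_set G (Suc j) A) W)
        \<le> (real k + 1) * c (Suc j) * measure M (act_set \<phi> (product_set G j A) W)"
      using step[OF _ closed, of "Suc j"] Suc.prems by simp
    also have "\<dots> \<le> (real k + 1) * c (Suc j) * ((real k + 1) ^ j * (\<Prod>i=1..j. c i) * measure M W)"
      using Suc c[of "Suc j"] by (intro mult_left_mono) auto
    finally show ?case by (simp add: prod.atLeast_Suc_atMost mult_ac)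
  qed
  thus thesis using W that by blast
qed

end

section \<open>Powers of an action\<close>

text \<open>
  The restriction to \<open>X\<^sup>I\<close> is there because group actions are homomorphisms into the group of
  extensional bijections.
\<close>

definition product_action ::
    "'i set \<Rightarrow> 'x set \<Rightarrow> ('g \<Rightarrow> 'x \<Rightarrow> 'x) \<Rightarrow> ('i \<Rightarrow> 'g) \<Rightarrow> ('i \<Rightarrow> 'x) \<Rightarrow> ('i \<Rightarrow> 'x)" where
  "product_action I X \<phi> g = (\<lambda>x\<in>(\<Pi>\<^sub>E i\<in>I. X). \<lambda>i\<in>I. \<phi> (g i) (x i))"

context abelian_pmp_action
begin

lemma product_action_closed:
  assumes "g \<in> (\<Pi>\<^sub>E i\<in>I. carrier G)" "x \<in> (\<Pi>\<^sub>E i\<in>I. space M)"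
  shows "product_action I (space M) \<phi> g x \<in> (\<Pi>\<^sub>E i\<in>I. space M)"
  using assms by (auto simp: product_action_def PiE_iff action_closed)

lemma product_action_inv_cancel:
  assumes "g \<in> (\<Pi>\<^sub>E i\<in>I. carrier G)" "x \<in> (\<Pi>\<^sub>E i\<in>I. space M)"
  shows "product_action I (space M) \<phi> (\<lambda>i\<in>I. inv (g i)) (product_action I (space M) \<phi> g x) = x"
    and "product_action I (space M) \<phi> g (product_action I (space M) \<phi> (\<lambda>i\<in>I. inv (g i)) x) = x"
  using assms
  by (auto simp: product_action_def PiE_iff action_closed action_inv_cancel extensional_def fun_eq_iff)

lemma product_action_Bij:
  assumes g: "g \<in> (\<Pi>\<^sub>E i\<in>I. carrier G)"
  shows "product_action I (space M) \<phi> g \<in> Bij (\<Pi>\<^sub>E i\<in>I. space M)"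
proof -
  have g': "(\<lambda>i\<in>I. inv (g i)) \<in> (\<Pi>\<^sub>E i\<in>I. carrier G)" using g by (auto simp: PiE_iff)
  have "bij_betw (product_action I (space M) \<phi> g) (\<Pi>\<^sub>E i\<in>I. space M) (\<Pi>\<^sub>E i\<in>I. space M)"
    by (rule bij_betw_byWitness[where f' = "product_action I (space M) \<phi> (\<lambda>i\<in>I. inv (g i))"])
      (auto simp only: product_action_inv_cancel[OF g] image_subset_iff
        intro!: product_action_closed g g')
  thus ?thesis by (auto simp: Bij_def product_action_def)
qed

lemma product_group_action:
  "group_action (product_group I (\<lambda>_. G)) (\<Pi>\<^sub>E i\<in>I. space M) (product_action I (space M) \<phi>)"
proof (intro group_action.intro group_hom.intro group_hom_axioms.intro group_BijGroup homI)
  show "group (product_group I (\<lambda>_. G))" by (simp add: is_group)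
next
  fix g assume "g \<in> carrier (product_group I (\<lambda>_. G))"
  thus "product_action I (space M) \<phi> g \<in> carrier (BijGroup (\<Pi>\<^sub>E i\<in>I. space M))"
    by (simp add: BijGroup_def product_action_Bij)
next
  fix g h assume gh: "g \<in> carrier (product_group I (\<lambda>_. G))" "h \<in> carrier (product_group I (\<lambda>_. G))"
  have "product_action I (space M) \<phi> (\<lambda>i\<in>I. g i \<otimes> h i)
      = compose (\<Pi>\<^sub>E i\<in>I. space M) (product_action I (space M) \<phi> g) (product_action I (space M) \<phi> h)"
    using gh by (auto simp: product_action_def compose_def PiE_iff composition_rule action_closed
        intro!: restrict_ext)
  thus "product_action I (space M) \<phi> (g \<otimes>\<^bsub>product_group I (\<lambda>_. G)\<^esub> h)
      = product_action I (space M) \<phi> g \<otimes>\<^bsub>BijGroup (\<Pi>\<^sub>E i\<in>I. space M)\<^esub> product_action I (space M) \<phi> h"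
    using gh by (simp add: BijGroup_def product_action_Bij)
qed

lemma product_action_measurable:
  assumes g: "g \<in> (\<Pi>\<^sub>E i\<in>I. carrier G)"
  shows "product_action I (space M) \<phi> g \<in> measurable (\<Pi>\<^sub>M i\<in>I. M) (\<Pi>\<^sub>M i\<in>I. M)"
proof -
  have "(\<lambda>x. \<lambda>i\<in>I. \<phi> (g i) (x i)) \<in> measurable (\<Pi>\<^sub>M i\<in>I. M) (\<Pi>\<^sub>M i\<in>I. M)"
  proof (rule measurable_restrict)
    fix i assume "i \<in> I"
    hence "\<phi> (g i) \<in> measurable M M" using g by (intro action_measurable) auto
    thus "(\<lambda>x. \<phi> (g i) (x i)) \<in> measurable (\<Pi>\<^sub>M i\<in>I. M) M"
      using \<open>i \<in> I\<close> by (rule measurable_compose[OF measurable_component_singleton, rotated])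
  qed
  thus ?thesis
    by (subst measurable_cong[where g = "\<lambda>x. \<lambda>i\<in>I. \<phi> (g i) (x i)"])
      (auto simp: product_action_def space_PiM)
qed

lemma emeasure_vimage:
  assumes "g \<in> carrier G" "Z \<in> sets M"
  shows "emeasure M (\<phi> g -` Z \<inter> space M) = emeasure M Z"
  using assms image_eq_vimage_inv[of "inv g" Z] action_emeasure[of "inv g" Z] sets.sets_into_space[of Z M]
  by simp

text \<open>
  It suffices to compare the two measures on boxes, where the coordinates separate.
\<close>

lemma distr_product_action:
  assumes I: "finite I" and g: "g \<in> (\<Pi>\<^sub>E i\<in>I. carrier G)"
  shows "distr (\<Pi>\<^sub>M i\<in>I. M) (\<Pi>\<^sub>M i\<in>I. M) (product_action I (space M) \<phi> g) = (\<Pi>\<^sub>M i\<in>I. M)"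
proof -
  interpret product_sigma_finite "\<lambda>_. M" by unfold_locales
  show ?thesis
  proof (rule PiM_eqI)
    fix A assume A: "\<And>i. i \<in> I \<Longrightarrow> A i \<in> sets M"
    have "product_action I (space M) \<phi> g -` Pi\<^sub>E I A \<inter> space (\<Pi>\<^sub>M i\<in>I. M)
        = (\<Pi>\<^sub>E i\<in>I. \<phi> (g i) -` A i \<inter> space M)"
      by (auto simp: product_action_def space_PiM PiE_iff)
    hence "emeasure (distr (\<Pi>\<^sub>M i\<in>I. M) (\<Pi>\<^sub>M i\<in>I. M) (product_action I (space M) \<phi> g)) (Pi\<^sub>E I A)
        = emeasure (\<Pi>\<^sub>M i\<in>I. M) (\<Pi>\<^sub>E i\<in>I. \<phi> (g i) -` A i \<inter> space M)"
      using A I by (subst emeasure_distr)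
        (auto intro!: product_action_measurable g sets_PiM_I_finite)
    also have "\<dots> = (\<Prod>i\<in>I. emeasure M (\<phi> (g i) -` A i \<inter> space M))"
      using A I g by (intro emeasure_PiM measurable_sets[OF action_measurable]) auto
    also have "\<dots> = (\<Prod>i\<in>I. emeasure M (A i))"
      using A g by (intro prod.cong emeasure_vimage) auto
    finally show "emeasure (distr (\<Pi>\<^sub>M i\<in>I. M) (\<Pi>\<^sub>M i\<in>I. M) (product_action I (space M) \<phi> g)) (Pi\<^sub>E I A)
        = (\<Prod>i\<in>I. emeasure M (A i))" .
  qed (use I in auto)
qed

proposition abelian_pmp_product_action:
  assumes I: "finite I"
  shows "abelian_pmp_action (product_group I (\<lambda>_. G)) (\<Pi>\<^sub>M i\<in>I. M) (product_action I (space M) \<phi>)"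
proof -
  interpret A: group_action "product_group I (\<lambda>_. G)" "space (\<Pi>\<^sub>M i\<in>I. M)" "product_action I (space M) \<phi>"
    unfolding space_PiM by (rule product_group_action)
  interpret P: group "product_group I (\<lambda>_. G)" by (simp add: is_group)
  have emeasure: "emeasure (\<Pi>\<^sub>M i\<in>I. M) (product_action I (space M) \<phi> g ` D) = emeasure (\<Pi>\<^sub>M i\<in>I. M) D"
    if g: "g \<in> carrier (product_group I (\<lambda>_. G))" and D: "D \<in> sets (\<Pi>\<^sub>M i\<in>I. M)" for g D
  proof -
    define h where "h = (\<lambda>i\<in>I. inv (g i))"
    have g: "g \<in> (\<Pi>\<^sub>E i\<in>I. carrier G)" using g by simp
    have h: "h \<in> (\<Pi>\<^sub>E i\<in>I. carrier G)" using g by (auto simp: PiE_iff h_def)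
    have sub: "D \<subseteq> (\<Pi>\<^sub>E i\<in>I. space M)" using sets.sets_into_space[OF D] by (simp add: space_PiM)
    have "product_action I (space M) \<phi> g ` D
        = product_action I (space M) \<phi> h -` D \<inter> (\<Pi>\<^sub>E i\<in>I. space M)"
    proof (intro equalityI subsetI)
      fix x assume "x \<in> product_action I (space M) \<phi> h -` D \<inter> (\<Pi>\<^sub>E i\<in>I. space M)"
      thus "x \<in> product_action I (space M) \<phi> g ` D"
        using product_action_inv_cancel(2)[OF g, of x] unfolding h_def
        by (metis IntE image_eqI vimageE)
    next
      fix x assume "x \<in> product_action I (space M) \<phi> g ` D"
      then obtain y where "y \<in> D" "x = product_action I (space M) \<phi> g y" by blast
      thus "x \<in> product_action I (space M) \<phi> h -` D \<inter> (\<Pi>\<^sub>E i\<in>I. space M)"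
        using product_action_inv_cancel(1)[OF g, of y] product_action_closed[OF g, of y] sub
        by (auto simp: h_def subset_iff simp del: PiE_iff)
    qed
    hence "emeasure (\<Pi>\<^sub>M i\<in>I. M) (product_action I (space M) \<phi> g ` D)
        = emeasure (distr (\<Pi>\<^sub>M i\<in>I. M) (\<Pi>\<^sub>M i\<in>I. M) (product_action I (space M) \<phi> h)) D"
      using D by (subst emeasure_distr) (auto simp: space_PiM intro!: product_action_measurable h)
    thus ?thesis by (simp add: distr_product_action[OF I h])
  qed
  show ?thesis
  proof (intro abelian_pmp_action.intro measure_preserving_action.intro
      measure_preserving_action_axioms.intro abelian_pmp_action_axioms.intro A.group_action_axioms)
    show "comm_group (product_group I (\<lambda>_. G))"
      by (rule P.group_comm_groupI) (auto intro!: restrict_ext m_comm simp: PiE_iff)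
    show "prob_space (\<Pi>\<^sub>M i\<in>I. M)" by (intro prob_space_PiM prob_space_axioms)
    show "countable (carrier (product_group I (\<lambda>_. G)))"
      using I by (simp add: countable_PiE countable_carrier)
  qed (use emeasure product_action_measurable in simp_all)
qed

end

section \<open>Growth in powers of an action\<close>

lemma (in prob_space) emeasure_PiM_eq_fibres:
  assumes I: "finite I" "i \<in> I" and E: "E \<in> sets (\<Pi>\<^sub>M i\<in>I. M)"
  shows "emeasure (\<Pi>\<^sub>M i\<in>I. M) E
    = (\<integral>\<^sup>+x. emeasure M {y \<in> space M. x(i := y) \<in> E} \<partial>(\<Pi>\<^sub>M i\<in>I - {i}. M))"
  and "x \<in> space (\<Pi>\<^sub>M i\<in>I - {i}. M) \<Longrightarrow> {y \<in> space M. x(i := y) \<in> E} \<in> sets M"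
  and "(\<lambda>x. emeasure M {y \<in> space M. x(i := y) \<in> E}) \<in> borel_measurable (\<Pi>\<^sub>M i\<in>I - {i}. M)"
proof -
  interpret product_sigma_finite "\<lambda>_. M" by unfold_locales
  have ins: "insert i (I - {i}) = I" using I by auto
  have fibre: "{y \<in> space M. x(i := y) \<in> E} \<in> sets M"
    if x: "x \<in> space (\<Pi>\<^sub>M i\<in>I - {i}. M)" for x
  proof -
    have "(\<lambda>y. x(i := y)) \<in> measurable M (\<Pi>\<^sub>M i\<in>I. M)"
      using measurable_component_update[OF x, of i] unfolding ins by simp
    from measurable_sets[OF this E] show ?thesis by (simp add: vimage_def Int_def conj_commute)
  qed
  show "x \<in> space (\<Pi>\<^sub>M i\<in>I - {i}. M) \<Longrightarrow> {y \<in> space M. x(i := y) \<in> E} \<in> sets M"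
    by (rule fibre)
  have fibre_integral: "(\<integral>\<^sup>+y. indicator E (x(i := y)) \<partial>M) = emeasure M {y \<in> space M. x(i := y) \<in> E}"
    if x: "x \<in> space (\<Pi>\<^sub>M i\<in>I - {i}. M)" for x
  proof -
    have "(\<integral>\<^sup>+y. indicator E (x(i := y)) \<partial>M) = (\<integral>\<^sup>+y. indicator {y \<in> space M. x(i := y) \<in> E} y \<partial>M)"
      by (intro nn_integral_cong) (auto simp: indicator_def)
    thus ?thesis using fibre[OF x] by simp
  qed
  have "(\<lambda>p. (fst p)(i := snd p)) \<in> measurable ((\<Pi>\<^sub>M i\<in>I - {i}. M) \<Otimes>\<^sub>M M) (\<Pi>\<^sub>M i\<in>I. M)"
    using measurable_add_dim[of i "I - {i}" "\<lambda>_. M"] unfolding ins by (simp add: case_prod_beta')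
  hence "(\<lambda>p. indicator E ((fst p)(i := snd p)) :: ennreal)
      \<in> borel_measurable ((\<Pi>\<^sub>M i\<in>I - {i}. M) \<Otimes>\<^sub>M M)"
    using E by measurable
  hence "(\<lambda>x. \<integral>\<^sup>+y. indicator E (x(i := y)) \<partial>M) \<in> borel_measurable (\<Pi>\<^sub>M i\<in>I - {i}. M)"
    by (intro borel_measurable_nn_integral) (simp add: case_prod_beta')
  thus "(\<lambda>x. emeasure M {y \<in> space M. x(i := y) \<in> E}) \<in> borel_measurable (\<Pi>\<^sub>M i\<in>I - {i}. M)"
    using fibre_integral by (simp cong: measurable_cong)
  have "emeasure (\<Pi>\<^sub>M i\<in>I. M) E = (\<integral>\<^sup>+x. indicator E x \<partial>(\<Pi>\<^sub>M i\<in>insert i (I - {i}). M))"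
    unfolding ins using E by simp
  also have "\<dots> = (\<integral>\<^sup>+x. (\<integral>\<^sup>+y. indicator E (x(i := y)) \<partial>M) \<partial>(\<Pi>\<^sub>M i\<in>I - {i}. M))"
    using I E by (intro product_nn_integral_insert) (auto simp only: ins borel_measurable_indicator
      finite_Diff Diff_iff insert_iff)
  also have "\<dots> = (\<integral>\<^sup>+x. emeasure M {y \<in> space M. x(i := y) \<in> E} \<partial>(\<Pi>\<^sub>M i\<in>I - {i}. M))"
    by (intro nn_integral_cong fibre_integral)
  finally show "emeasure (\<Pi>\<^sub>M i\<in>I. M) E
    = (\<integral>\<^sup>+x. emeasure M {y \<in> space M. x(i := y) \<in> E} \<partial>(\<Pi>\<^sub>M i\<in>I - {i}. M))" .
qed

context abelian_pmp_action
begin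

text \<open>
  Acting by \<open>A\<close> on the coordinate \<open>i\<close> only amounts to acting by \<open>A\<close> on each fibre in the
  direction \<open>i\<close>. All these fibres are subsets of \<open>B\<close>, so each of them grows by the factor \<open>c\<close>,
  and so does their integral.
\<close>

lemma growth_one_coordinate:
  assumes I: "finite I" "i \<in> I" and A: "A \<subseteq> carrier G" and c: "0 \<le> c"
    and growth: "\<And>Z. Z \<in> sets M \<Longrightarrow> Z \<subseteq> B \<Longrightarrow> c * measure M Z \<le> measure M (act_set \<phi> A Z)"
    and E: "E \<in> sets (\<Pi>\<^sub>M i\<in>I. M)" and EB: "\<And>x. x \<in> E \<Longrightarrow> x i \<in> B"
  shows "c * measure (\<Pi>\<^sub>M i\<in>I. M) E
    \<le> measure (\<Pi>\<^sub>M i\<in>I. M) (act_set (product_action I (space M) \<phi>) (\<Pi>\<^sub>E l\<in>I. if l = i then A else {\<one>}) E)"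
proof -
  interpret P: abelian_pmp_action "product_group I (\<lambda>_. G)" "\<Pi>\<^sub>M i\<in>I. M" "product_action I (space M) \<phi>"
    using I by (intro abelian_pmp_product_action)
  define E' where "E' = act_set (product_action I (space M) \<phi>) (\<Pi>\<^sub>E l\<in>I. if l = i then A else {\<one>}) E"
  have E': "E' \<in> sets (\<Pi>\<^sub>M i\<in>I. M)"
    unfolding E'_def
  proof (rule P.act_set_sets[OF _ E])
    have "(if l = i then A else {\<one>}) \<subseteq> carrier G" for l using A by simp
    thus "(\<Pi>\<^sub>E l\<in>I. if l = i then A else {\<one>}) \<subseteq> carrier (product_group I (\<lambda>_. G))"
      unfolding carrier_product_group by (intro PiE_mono)
  qed
  have sub: "E \<subseteq> (\<Pi>\<^sub>E i\<in>I. space M)" using sets.sets_into_space[OF E] by (simp add: space_PiM)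
  define fib where "fib D x = {y \<in> space M. x(i := y) \<in> D}" for D x
  note fibres = emeasure_PiM_eq_fibres[OF I, folded fib_def]
  have fibre_le: "ennreal c * emeasure M (fib E x) \<le> emeasure M (fib E' x)"
    if x: "x \<in> space (\<Pi>\<^sub>M i\<in>I - {i}. M)" for x
  proof -
    have "act_set \<phi> A (fib E x) \<subseteq> fib E' x"
    proof
      fix z assume "z \<in> act_set \<phi> A (fib E x)"
      then obtain a y where a: "a \<in> A" and y: "y \<in> space M" "x(i := y) \<in> E" and z: "z = \<phi> a y"
        by (auto simp: act_set_def fib_def)
      define g where "g = (\<lambda>l\<in>I. if l = i then a else \<one>)"
      have "product_action I (space M) \<phi> g (x(i := y)) = x(i := z)"
      proof
        fix l
        show "product_action I (space M) \<phi> g (x(i := y)) l = (x(i := z)) l"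
          using x y sub I z
          by (cases "l \<in> I") (auto simp: product_action_def g_def space_PiM PiE_iff action_one
              extensional_def subset_iff)
      qed
      moreover have "g \<in> (\<Pi>\<^sub>E l\<in>I. if l = i then A else {\<one>})" using a by (auto simp: g_def)
      ultimately have "x(i := z) \<in> E'"
        unfolding E'_def act_set_def using y(2) by force
      moreover have "z \<in> space M" using z a A y action_closed by blast
      ultimately show "z \<in> fib E' x" by (simp add: fib_def)
    qed
    hence "measure M (act_set \<phi> A (fib E x)) \<le> measure M (fib E' x)"
      using fibres(2)[OF E' x] by (intro finite_measure_mono)
    moreover have "c * measure M (fib E x) \<le> measure M (act_set \<phi> A (fib E x))"
      using fibres(2)[OF E x] EB by (intro growth) (force simp: fib_def)+
    ultimately have "c * measure M (fib E x) \<le> measure M (fib E' x)" by linarith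
    thus ?thesis using c by (simp add: emeasure_eq_measure ennreal_mult[symmetric])
  qed
  have "ennreal c * emeasure (\<Pi>\<^sub>M i\<in>I. M) E
      = (\<integral>\<^sup>+x. ennreal c * emeasure M (fib E x) \<partial>(\<Pi>\<^sub>M i\<in>I - {i}. M))"
    unfolding fibres(1)[OF E] using fibres(3)[OF E] by (simp add: nn_integral_cmult)
  also have "\<dots> \<le> (\<integral>\<^sup>+x. emeasure M (fib E' x) \<partial>(\<Pi>\<^sub>M i\<in>I - {i}. M))"
    by (intro nn_integral_mono fibre_le)
  also have "\<dots> = emeasure (\<Pi>\<^sub>M i\<in>I. M) E'"
    using fibres(1)[OF E'] by simp
  finally show ?thesis
    using c by (simp add: P.emeasure_eq_measure ennreal_mult[symmetric] E'_def)
qed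

text \<open>
  The action of \<open>A\<^sup>I\<close> is performed one coordinate at a time. Coordinates that have not been
  touched yet still lie in \<open>B\<close>, as the one-coordinate bound requires, although the others may
  have left it.
\<close>

proposition growth_power:
  assumes I: "finite I" and A: "A \<subseteq> carrier G" and c: "0 \<le> c"
    and growth: "\<And>Z. Z \<in> sets M \<Longrightarrow> Z \<subseteq> B \<Longrightarrow> c * measure M Z \<le> measure M (act_set \<phi> A Z)"
    and D: "D \<in> sets (\<Pi>\<^sub>M i\<in>I. M)" "D \<subseteq> (\<Pi>\<^sub>E i\<in>I. B)"
  shows "c ^ card I * measure (\<Pi>\<^sub>M i\<in>I. M) D
    \<le> measure (\<Pi>\<^sub>M i\<in>I. M) (act_set (product_action I (space M) \<phi>) (\<Pi>\<^sub>E i\<in>I. A) D)"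
proof -
  interpret P: abelian_pmp_action "product_group I (\<lambda>_. G)" "\<Pi>\<^sub>M i\<in>I. M" "product_action I (space M) \<phi>"
    using I by (rule abelian_pmp_product_action)
  define T where "T J = (\<Pi>\<^sub>E l\<in>I. if l \<in> J then A else {\<one>})" for J
  define act where "act = act_set (product_action I (space M) \<phi>)"
  have T_closed: "T J \<subseteq> carrier (product_group I (\<lambda>_. G))" for J
  proof -
    have "(if l \<in> J then A else {\<one>}) \<subseteq> carrier G" for l using A by simp
    thus ?thesis unfolding carrier_product_group T_def by (intro PiE_mono)
  qed
  have sub: "D \<subseteq> (\<Pi>\<^sub>E i\<in>I. space M)" using sets.sets_into_space[OF D(1)] by (simp add: space_PiM)
  have "c ^ card J * measure (\<Pi>\<^sub>M i\<in>I. M) D \<le> measure (\<Pi>\<^sub>M i\<in>I. M) (act (T J) D)"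
    if "finite J" "J \<subseteq> I" for J
    using that
  proof (induction J rule: finite_induct)
    case empty
    have "(\<lambda>l\<in>I. \<one>) \<in> T {}" by (simp add: T_def)
    hence "D \<subseteq> act (T {}) D"
      using P.action_one sub unfolding act_def act_set_eq_UN
      by (force simp: space_PiM simp del: PiE_iff)
    thus ?case using D P.act_set_sets[OF T_closed D(1)] unfolding act_def
      by (auto intro!: P.finite_measure_mono)
  next
    case (insert i J)
    have fixed: "x i \<in> B" if x: "x \<in> act (T J) D" for x
    proof -
      obtain g y where "g \<in> T J" "y \<in> D" "x = product_action I (space M) \<phi> g y"
        using x by (auto simp: act_def act_set_def)
      moreover from this have "y i \<in> B" "y \<in> (\<Pi>\<^sub>E i\<in>I. space M)" using D sub insert.prems by auto
      ultimately show ?thesis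
        using insert.prems insert.hyps
        by (auto simp: product_action_def T_def PiE_iff action_one)
    qed
    have comp: "T {i} <#>\<^bsub>product_group I (\<lambda>_. G)\<^esub> T J \<subseteq> T (insert i J)"
    proof
      fix f assume "f \<in> T {i} <#>\<^bsub>product_group I (\<lambda>_. G)\<^esub> T J"
      then obtain a b where ab: "a \<in> T {i}" "b \<in> T J" and f: "f = (\<lambda>l\<in>I. a l \<otimes> b l)"
        by (auto simp: set_mult_def)
      have "a l \<otimes> b l \<in> (if l \<in> insert i J then A else {\<one>})" if l: "l \<in> I" for l
        using PiE_mem[OF ab(1)[unfolded T_def] l] PiE_mem[OF ab(2)[unfolded T_def] l]
          insert.hyps A by (cases "l = i"; cases "l \<in> J") auto
      thus "f \<in> T (insert i J)" unfolding f T_def by (intro restrict_PiE_iff[THEN iffD2]) blast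
    qed
    have "c ^ card (insert i J) * measure (\<Pi>\<^sub>M i\<in>I. M) D
        \<le> c * measure (\<Pi>\<^sub>M i\<in>I. M) (act (T J) D)"
      using insert c by (simp add: mult_left_mono mult.assoc)
    also have "\<dots> \<le> measure (\<Pi>\<^sub>M i\<in>I. M) (act (T {i}) (act (T J) D))"
      using growth_one_coordinate[OF I _ A c growth, of i B "act (T J) D"] insert.prems fixed
        P.act_set_sets[OF T_closed D(1), of J]
      by (simp add: act_def T_def)
    also have "act (T {i}) (act (T J) D) = act (T {i} <#>\<^bsub>product_group I (\<lambda>_. G)\<^esub> T J) D"
      unfolding act_def using T_closed sub by (intro P.act_set_act_set) (simp_all add: space_PiM)
    also have "measure (\<Pi>\<^sub>M i\<in>I. M) \<dots> \<le> measure (\<Pi>\<^sub>M i\<in>I. M) (act (T (insert i J)) D)"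
      unfolding act_def using comp
      by (intro P.finite_measure_mono act_set_mono P.act_set_sets T_closed D(1)) auto
    finally show ?case .
  qed
  from this[OF I order_refl] have "c ^ card I * measure (\<Pi>\<^sub>M i\<in>I. M) D \<le> measure (\<Pi>\<^sub>M i\<in>I. M) (act (T I) D)" .
  moreover have "T I = (\<Pi>\<^sub>E i\<in>I. A)" by (auto simp: T_def intro!: PiE_cong)
  ultimately show ?thesis by (simp add: act_def)
qed

text \<open>
  The powers of the sets \<open>A j\<close> are multiplied in the product group, so that a tuple of
  products is obtained by choosing the factors in each coordinate independently.
\<close>

lemma product_set_power:
  assumes I: "finite I" and A: "\<And>j. j \<in> {1..k} \<Longrightarrow> A j \<subseteq> carrier G"
  shows "(\<Pi>\<^sub>E i\<in>I. product_set G k A) \<subseteq> product_set (product_group I (\<lambda>_. G)) k (\<lambda>j. \<Pi>\<^sub>E i\<in>I. A j)"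
  using A
proof (induction k)
  interpret P: abelian_pmp_action "product_group I (\<lambda>_. G)" "\<Pi>\<^sub>M i\<in>I. M" "product_action I (space M) \<phi>"
    using I by (rule abelian_pmp_product_action)
  case 0
  show ?case by (auto simp: product_set_0 P.product_set_0 PiE_iff extensional_def)
next
  interpret P: abelian_pmp_action "product_group I (\<lambda>_. G)" "\<Pi>\<^sub>M i\<in>I. M" "product_action I (space M) \<phi>"
    using I by (rule abelian_pmp_product_action)
  case (Suc k)
  have split: "product_set G (Suc k) A = A (Suc k) <#> product_set G k A"
    using Suc.prems by (rule product_set_Suc)
  have split_power: "product_set (product_group I (\<lambda>_. G)) (Suc k) (\<lambda>j. \<Pi>\<^sub>E i\<in>I. A j)
    = (\<Pi>\<^sub>E i\<in>I. A (Suc k)) <#>\<^bsub>product_group I (\<lambda>_. G)\<^esub>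
        product_set (product_group I (\<lambda>_. G)) k (\<lambda>j. \<Pi>\<^sub>E i\<in>I. A j)"
    using Suc.prems by (intro P.product_set_Suc) (auto simp: PiE_iff)
  show ?case
  proof
    fix f assume f: "f \<in> (\<Pi>\<^sub>E i\<in>I. product_set G (Suc k) A)"
    hence "\<forall>i\<in>I. \<exists>a p. a \<in> A (Suc k) \<and> p \<in> product_set G k A \<and> f i = a \<otimes> p"
      unfolding split set_mult_def PiE_iff by blast
    then obtain a p where ap: "\<And>i. i \<in> I \<Longrightarrow> a i \<in> A (Suc k)"
      "\<And>i. i \<in> I \<Longrightarrow> p i \<in> product_set G k A" "\<And>i. i \<in> I \<Longrightarrow> f i = a i \<otimes> p i" by metis
    have "f = restrict a I \<otimes>\<^bsub>product_group I (\<lambda>_. G)\<^esub> restrict p I"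
      using f ap(3) by (auto simp: fun_eq_iff PiE_iff extensional_def)
    moreover have "restrict a I \<in> (\<Pi>\<^sub>E i\<in>I. A (Suc k))" using ap by auto
    moreover have "restrict p I \<in> (\<Pi>\<^sub>E i\<in>I. product_set G k A)" using ap by auto
    hence "restrict p I \<in> product_set (product_group I (\<lambda>_. G)) k (\<lambda>j. \<Pi>\<^sub>E i\<in>I. A j)"
      by (rule subsetD[OF Suc.IH, rotated]) (use Suc.prems in simp)
    ultimately show "f \<in> product_set (product_group I (\<lambda>_. G)) (Suc k) (\<lambda>j. \<Pi>\<^sub>E i\<in>I. A j)"
      unfolding split_power set_mult_def by blast
  qed
qed

end

section \<open>Removing the constant\<close>

lemma (in prob_space) measure_PiM_cube:
  assumes "finite I" "Z \<in> sets M"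
  shows "measure (\<Pi>\<^sub>M i\<in>I. M) (\<Pi>\<^sub>E i\<in>I. Z) = measure M Z ^ card I"
proof -
  interpret finite_product_prob_space "\<lambda>_. M" I
    using assms by unfold_locales
  show ?thesis using assms finite_measure_PiM_emb[of "\<lambda>_. Z"] by simp
qed

lemma le_if_power_le_const_mult_power:
  fixes c p K :: real
  assumes p: "0 < p" and le: "\<And>n::nat. c ^ n \<le> K * p ^ n"
  shows "c \<le> p"
proof (rule ccontr)
  assume "\<not> c \<le> p"
  hence "1 < c / p" using p by simp
  then obtain n where "K < (c / p) ^ n" using real_arch_pow by blast
  thus False using le[of n] p by (simp add: power_divide field_simps)
qed

context abelian_pmp_action
begin

text \<open>
  The tensor power trick: the bound with a constant, applied to the action on the \<open>n\<close>th power,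
  produces a set \<open>W\<close> for which the growth of \<open>A\<^sub>1 \<cdots> A\<^sub>k\<close> is bounded from above with a constant
  independent of \<open>n\<close>, and from below by the \<open>n\<close>th power of \<open>c\<close>.
\<close>

proposition uniform_growth_le_prod:
  fixes \<alpha> :: "nat \<Rightarrow> real"
  assumes A: "\<And>i. i \<in> {1..k} \<Longrightarrow> A i \<subseteq> carrier G"
    and B: "B \<in> sets M" "0 < measure M B"
    and \<alpha>: "\<And>i. i \<in> {1..k} \<Longrightarrow> 0 < \<alpha> i"
    and growth: "\<And>i. i \<in> {1..k} \<Longrightarrow> measure M (act_set \<phi> (A i) B) \<le> \<alpha> i * measure M B"
    and c: "0 \<le> c"
    and uniform: "\<And>Z. Z \<in> sets M \<Longrightarrow> Z \<subseteq> B \<Longrightarrow>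
        c * measure M Z \<le> measure M (act_set \<phi> (product_set G k A) Z)"
  shows "c \<le> (\<Prod>i=1..k. \<alpha> i)"
proof (rule le_if_power_le_const_mult_power)
  show "0 < (\<Prod>i=1..k. \<alpha> i)" using \<alpha> by (intro prod_pos)
  fix n :: nat
  define I where "I = {..<n}"
  have I: "finite I" "card I = n" by (simp_all add: I_def)
  interpret P: abelian_pmp_action "product_group I (\<lambda>_. G)" "\<Pi>\<^sub>M i\<in>I. M" "product_action I (space M) \<phi>"
    using I(1) by (rule abelian_pmp_product_action)
  let ?act = "act_set (product_action I (space M) \<phi>)"
  let ?AI = "\<lambda>j. \<Pi>\<^sub>E i\<in>I. A j"
  have AI: "?AI j \<subseteq> carrier (product_group I (\<lambda>_. G))" if "j \<in> {1..k}" for j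
    using A[OF that] unfolding carrier_product_group by (intro PiE_mono)
  have BI: "(\<Pi>\<^sub>E i\<in>I. B) \<in> sets (\<Pi>\<^sub>M i\<in>I. M)"
    using B I by (intro sets_PiM_I_finite)
  have growth_cubes: "measure (\<Pi>\<^sub>M i\<in>I. M) (?act (?AI j) (\<Pi>\<^sub>E i\<in>I. B))
      \<le> \<alpha> j ^ n * measure (\<Pi>\<^sub>M i\<in>I. M) (\<Pi>\<^sub>E i\<in>I. B)" if j: "j \<in> {1..k}" for j
  proof -
    have AB: "act_set \<phi> (A j) B \<in> sets M" using A[OF j] B by blast
    have "?act (?AI j) (\<Pi>\<^sub>E i\<in>I. B) \<subseteq> (\<Pi>\<^sub>E i\<in>I. act_set \<phi> (A j) B)"
    proof
      fix x assume "x \<in> ?act (?AI j) (\<Pi>\<^sub>E i\<in>I. B)"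
      then obtain g y where g: "g \<in> ?AI j" and y: "y \<in> (\<Pi>\<^sub>E i\<in>I. B)"
        and x: "x = product_action I (space M) \<phi> g y" by (auto simp: act_set_def)
      have "y \<in> (\<Pi>\<^sub>E i\<in>I. space M)" using y sets.sets_into_space[OF B(1)] by (auto simp: PiE_iff)
      hence "x = (\<lambda>i\<in>I. \<phi> (g i) (y i))" unfolding x product_action_def by simp
      moreover have "\<phi> (g i) (y i) \<in> act_set \<phi> (A j) B" if "i \<in> I" for i
        using PiE_mem[OF g that] PiE_mem[OF y that] by (auto simp: act_set_def)
      ultimately show "x \<in> (\<Pi>\<^sub>E i\<in>I. act_set \<phi> (A j) B)" by simp
    qed
    hence "measure (\<Pi>\<^sub>M i\<in>I. M) (?act (?AI j) (\<Pi>\<^sub>E i\<in>I. B))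
        \<le> measure (\<Pi>\<^sub>M i\<in>I. M) (\<Pi>\<^sub>E i\<in>I. act_set \<phi> (A j) B)"
      using AB I by (intro P.finite_measure_mono sets_PiM_I_finite)
    also have "\<dots> = measure M (act_set \<phi> (A j) B) ^ n"
      using measure_PiM_cube[OF I(1) AB] I by simp
    also have "\<dots> \<le> (\<alpha> j * measure M B) ^ n"
      using growth[OF j] by (intro power_mono) auto
    also have "\<dots> = \<alpha> j ^ n * measure (\<Pi>\<^sub>M i\<in>I. M) (\<Pi>\<^sub>E i\<in>I. B)"
      using measure_PiM_cube[OF I(1) B(1)] I by (simp add: power_mult_distrib)
    finally show ?thesis .
  qed
  obtain W where W: "W \<in> sets (\<Pi>\<^sub>M i\<in>I. M)" "W \<subseteq> (\<Pi>\<^sub>E i\<in>I. B)" "0 < measure (\<Pi>\<^sub>M i\<in>I. M) W"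
    and upper: "measure (\<Pi>\<^sub>M i\<in>I. M) (?act (product_set (product_group I (\<lambda>_. G)) k ?AI) W)
      \<le> (real k + 1) ^ k * (\<Prod>i=1..k. \<alpha> i ^ n) * measure (\<Pi>\<^sub>M i\<in>I. M) W"
  proof (rule P.exists_subset_product_growth[of k ?AI "\<Pi>\<^sub>E i\<in>I. B" "\<lambda>j. \<alpha> j ^ n"])
    show "0 < measure (\<Pi>\<^sub>M i\<in>I. M) (\<Pi>\<^sub>E i\<in>I. B)"
      using measure_PiM_cube[OF I(1) B(1)] B(2) by simp
  qed (use AI BI \<alpha> growth_cubes in auto)
  have "c ^ n * measure (\<Pi>\<^sub>M i\<in>I. M) W
      \<le> measure (\<Pi>\<^sub>M i\<in>I. M) (?act (\<Pi>\<^sub>E i\<in>I. product_set G k A) W)"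
    using growth_power[OF I(1) product_set_closed[OF A] c uniform W(1,2)] I by simp
  also have "\<dots> \<le> measure (\<Pi>\<^sub>M i\<in>I. M) (?act (product_set (product_group I (\<lambda>_. G)) k ?AI) W)"
    by (intro P.finite_measure_mono act_set_mono product_set_power I(1) A order_refl
        P.act_set_sets P.product_set_closed AI W(1))
  also note upper
  finally show "c ^ n \<le> (real k + 1) ^ k * (\<Prod>i=1..k. \<alpha> i) ^ n"
    using W(3) by (simp add: prod_power_distrib)
qed

end

theorem proposition6p2:
  fixes G :: "('g, 'm) monoid_scheme"
    and M :: "'x measure"
    and \<phi> :: "'g \<Rightarrow> 'x \<Rightarrow> 'x"
    and k :: nat
    and A :: "nat \<Rightarrow> 'g set"
    and B :: "'x set"
  assumes "comm_group G"
    and "countable (carrier G)"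
    and "prob_space M"
    and "measure_preserving_action G M \<phi>"
    and "k \<ge> 1"
    and "\<And>i. i \<in> {1..k} \<Longrightarrow> A i \<subseteq> carrier G"
    and "B \<in> sets M"
    and "emeasure M B > 0"
  shows "magnification_ratio M \<phi> (product_set G k A) B
           \<le> (\<Prod>i=1..k. emeasure M (act_set \<phi> (A i) B) / emeasure M B)"
proof -
  interpret abelian_pmp_action G M \<phi>
    using assms by (intro abelian_pmp_action.intro abelian_pmp_action_axioms.intro)
  note A = assms(6) and B = assms(7)
  define P where "P = product_set G k A"
  have B_pos: "0 < measure M B"
    using assms(8) by (simp add: emeasure_eq_measure)
  have ratio: "emeasure M Y / emeasure M Z = ennreal (measure M Y / measure M Z)"
    if "0 < measure M Z" for Y Z
    using that by (simp add: emeasure_eq_measure divide_ennreal)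
  have magnification_le: "magnification_ratio M \<phi> P B \<le> ennreal (measure M (act_set \<phi> P Z) / measure M Z)"
    if "Z \<in> sets M" "Z \<subseteq> B" "0 < measure M Z" for Z
    unfolding magnification_ratio_def using that
    by (intro Inf_lower) (auto simp: ratio[symmetric] emeasure_eq_measure intro!: exI[of _ Z])
  show ?thesis
    \<comment> \<open>An empty \<open>A i\<close> has growth \<open>0\<close>, which could not serve as a divisor in the weights; but then
      the product set is empty as well.\<close>
  proof (cases "\<exists>i\<in>{1..k}. A i = {}")
    case True
    hence "act_set \<phi> P B = {}" by (auto simp: P_def product_set_def act_set_def)
    hence "magnification_ratio M \<phi> P B \<le> 0"
      using magnification_le[OF B order_refl B_pos] by simp
    thus ?thesis by (simp add: P_def)
  next
    case False
    define c where "c = enn2real (magnification_ratio M \<phi> P B)"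
    have c: "magnification_ratio M \<phi> P B = ennreal c"
      using magnification_le[OF B order_refl B_pos]
      by (simp add: c_def less_top[symmetric] neq_top_trans[OF ennreal_neq_top])
    have "c \<le> (\<Prod>i=1..k. measure M (act_set \<phi> (A i) B) / measure M B)"
    proof (rule uniform_growth_le_prod[OF A B B_pos])
      show "0 < measure M (act_set \<phi> (A i) B) / measure M B" if "i \<in> {1..k}" for i
        using measure_le_act_set[OF A[OF that] _ B] False that B_pos by (intro divide_pos_pos) force+
      show "c * measure M Z \<le> measure M (act_set \<phi> (product_set G k A) Z)"
        if Z: "Z \<in> sets M" "Z \<subseteq> B" for Z
      proof (cases "measure M Z = 0")
        case False
        hence pos: "0 < measure M Z" by (simp add: zero_less_measure_iff)
        have "c \<le> measure M (act_set \<phi> P Z) / measure M Z"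
          using magnification_le[OF Z pos] by (simp add: c_def enn2real_leI)
        thus ?thesis using pos by (simp add: field_simps P_def)
      qed simp
    qed (use B_pos in \<open>simp_all add: c_def\<close>)
    hence "ennreal c \<le> (\<Prod>i=1..k. ennreal (measure M (act_set \<phi> (A i) B) / measure M B))"
      by (subst prod_ennreal) (simp_all add: ennreal_leI)
    thus ?thesis using ratio[OF B_pos] by (simp add: c[unfolded P_def])
  qed
qed

end
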